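(* Let $q\in\mathbb{R}$ and $n\in\mathbb{N}$, and let $A_n(x;q)$ be the $q$-Eulerian polynomials. (a) If $q>0$, then the $A_n(x;q)$ have nonpositive (real) and simple zeros for $n\ge 2$. (b) If $n+q\le 0$, then $A_{n+1}(x;q)\in\mathrm{RZ}[1,+\infty)$. (c) If $q$ is a negative integer, then $A_n(x;q)\in\mathrm{RZ}[1,+\infty)$ and $(x-1)^m\,\|\,A_n(x;q)$, where $m=\max\{n+q,0\}$. In particular, $A_n(x;-1)=-(x-1)^{n-1}$.
   Context: Let $S_n$ be the group of permutations of $\{1,2,\ldots,n\}$. For $\pi=a_1a_2\cdots a_n\in S_n$, an excedance of $\pi$ is an index $i$ such that $a_i>i$; $\mathrm{exc}(\pi)$ is the number of excedances of $\pi$ and $c(\pi)$ is the number of cycles of $\pi$. The $q$-Eulerian polynomials are $A_0(x;q)=1$ and $A_n(x;q)=\sum_{\pi\in S_n}x^{\mathrm{exc}(\pi)}q^{c(\pi)}$ for $n\ge1$, regarded as polynomials in $x$ for fixed real $q$. $\mathrm{RZ}[1,+\infty)$ denotes the set of real polynomials having only real zeros, all lying in the interval $[1,+\infty)$. The notation $(x-a)^m\,\|\,p(x)$ means that $(x-a)^m$ divides $p(x)$ but $(x-a)^{m+1}$ does not. *)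

theory Defs
  imports
    Complex_Main
    "HOL-Combinatorics.Combinatorics"
    "HOL-Computational_Algebra.Polynomial"
begin

definition exc :: "nat \<Rightarrow> (nat \<Rightarrow> nat) \<Rightarrow> nat" where
  "exc n \<pi> = card {i \<in> {1..n}. \<pi> i > i}"

text \<open>The cycles of a permutation of \<open>{1..n}\<close> are its orbits on \<open>{1..n}\<close>; a fixed point \<open>i\<close>
  contributes the cycle \<open>orbit \<pi> i = {i}\<close>.\<close>

definition cyc :: "nat \<Rightarrow> (nat \<Rightarrow> nat) \<Rightarrow> nat" where
  "cyc n \<pi> = card (orbit \<pi> ` {1..n})"

definition q_eulerian :: "nat \<Rightarrow> real \<Rightarrow> real poly" where
  "q_eulerian n q =
     (if n = 0 then 1 else \<Sum>\<pi> | \<pi> permutes {1..n}. monom (q ^ cyc n \<pi>) (exc n \<pi>))"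

text \<open>Zeros are taken in the complex numbers. The zero polynomial, which vanishes everywhere, does
  not have only real zeros and so belongs to no \<open>RZ S\<close>.\<close>

definition RZ :: "real set \<Rightarrow> real poly set" where
  "RZ S = {p. \<forall>z::complex. poly (map_poly complex_of_real p) z = 0 \<longrightarrow> z \<in> complex_of_real ` S}"

lemma zero_notin_RZ: "0 \<notin> RZ S"
proof
  assume "0 \<in> RZ S"
  then have "\<i> \<in> complex_of_real ` S"
    by (simp add: RZ_def)
  then show False
    by (auto simp: complex_eq_iff)
qed

definition simple_zeros :: "real poly \<Rightarrow> bool" where
  "simple_zeros p \<longleftrightarrow>
     (\<forall>z::complex. poly (map_poly complex_of_real p) z = 0 \<longrightarrow>
        order z (map_poly complex_of_real p) = 1)"

definition exact_pow_dvd :: "real \<Rightarrow> nat \<Rightarrow> real poly \<Rightarrow> bool" where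
  "exact_pow_dvd a m p \<longleftrightarrow> [:- a, 1:] ^ m dvd p \<and> \<not> [:- a, 1:] ^ (m + 1) dvd p"

end

theory Submission
  imports Defs "HOL-Computational_Algebra.Fundamental_Theorem_Algebra"
begin

text \<open>Inserting \<open>n + 1\<close> into the cycles of a permutation of \<open>{1..n}\<close> gives
  \<open>A\<^sub>n\<^sub>+\<^sub>1 = (n x + q) A\<^sub>n + x (1 - x) A\<^sub>n'\<close>. Let \<open>r\<^sub>i\<close> be the zeros of \<open>A\<^sub>n\<close>. A zero \<open>z\<close>
  of \<open>A\<^sub>n\<^sub>+\<^sub>1\<close> different from \<open>0\<close>, \<open>1\<close> and all \<open>r\<^sub>i\<close> satisfies
  \<open>q / z - (n + q) / (z - 1) + (\<Sum>i. 1 / (z - r\<^sub>i)) = 0\<close>.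

  If \<open>n + q \<le> 0\<close> and all \<open>r\<^sub>i > 1\<close>, multiply by \<open>z\<close>: the nonconstant terms are nonnegative multiples
  of \<open>z / (z - r)\<close> with \<open>r \<ge> 1\<close>, whose imaginary part has the sign opposite to that of \<open>Im z\<close>, so \<open>z\<close>
  is real; and for real \<open>z \<le> 1\<close> each quotient is at most \<open>1\<close>, which makes the sum too small.
  If \<open>q > 0\<close> and all \<open>r\<^sub>i < 0\<close>, multiply by \<open>z - 1\<close> instead: the imaginary part of
  \<open>(z - 1) / (z - r)\<close> has the sign of \<open>Im z\<close>, and on the negative axis the sum has positive derivative,
  which makes the zeros simple.

  For \<open>q = -m\<close> and \<open>k \<ge> 0\<close> the recurrence preserves the shape \<open>A\<^sub>m\<^sub>+\<^sub>k = (x - 1)^k B\<^sub>k\<close>, with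
  \<open>B\<^sub>k\<^sub>+\<^sub>1 = m B\<^sub>k - x B\<^sub>k'\<close>, and the first argument shows that the zeros of \<open>B\<^sub>k\<close> stay in \<open>(1, \<infinity>)\<close>.\<close>

section \<open>The recurrence\<close>

lemma q_eulerian_eq_sum:
  "q_eulerian n q = (\<Sum>\<pi> | \<pi> permutes {1..n}. monom (q ^ cyc n \<pi>) (exc n \<pi>))"
  by (simp add: q_eulerian_def cyc_def exc_def)

text \<open>\<open>transpose a b \<circ> p\<close> arises from \<open>p\<close> by inserting \<open>a\<close> immediately before \<open>b\<close> into
  the cycle of \<open>b\<close>.\<close>

lemma orbit_insert_minus:
  assumes p: "p permutes S" and a: "a \<notin> S" and b: "b \<in> S" and x: "x \<in> S"
  shows "orbit (transpose a b \<circ> p) x - {a} = orbit p x"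
proof -
  define f where "f = transpose a b \<circ> p"
  have fa: "f a = b"
    using permutes_not_in[OF p a] by (simp add: f_def)
  have fb: "f y = a" if "p y = b" for y
    using that by (simp add: f_def)
  have fo: "f y = p y" if "y \<in> S" "p y \<noteq> b" for y
    using that a permutes_in_image[OF p, of y] by (auto simp: f_def transpose_def)
  have orbS: "y \<in> S" if "y \<in> orbit p x" for y
    using that by induction (use x permutes_in_image[OF p] in auto)
  \<comment> \<open>If \<open>f y\<close> differs from \<open>p y\<close>, then
    \<open>f y = a\<close> and \<open>p y = b = f a\<close>, so one more step of \<open>f\<close>
    reaches \<open>p y\<close>.\<close>
  have pstep: "p y \<in> orbit f x" if "y \<in> S" "f y \<in> orbit f x" for y
    using that fa fb fo orbit.step[of a f x] by metis
  have 1: "y \<in> orbit f x" if "y \<in> orbit p x" for y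
    using that
  proof induction
    case base
    show ?case using pstep[OF x orbit.base] .
  next
    case (step y)
    then show ?case using pstep[of y] orbS orbit.step by metis
  qed
  \<comment> \<open>The point \<open>a\<close> is not in the orbit of \<open>p\<close>; in the
    induction its successor \<open>b\<close> stands in for it.\<close>
  have 2: "if y = a then b \<in> orbit p x else y \<in> orbit p x" if "y \<in> orbit f x" for y
    using that
  proof induction
    case base
    show ?case
      using fb[of x] fo[OF x] orbit.base[of p x] a permutes_in_image[OF p, of x] x
      by (metis)
  next
    case (step y)
    show ?case
    proof (cases "y = a")
      case True
      then show ?thesis using step fa a b by (auto split: if_splits)
    next
      case False
      then have y: "y \<in> orbit p x" using step by auto
      then show ?thesis
        using fb[of y] fo[of y] orbit.step[OF y] orbS a by metis
    qed
  qed
  show ?thesis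
    unfolding f_def[symmetric]
  proof (intro set_eqI iffI)
    fix y
    show "y \<in> orbit p x" if "y \<in> orbit f x - {a}"
      using 2[of y] that by auto
    show "y \<in> orbit f x - {a}" if "y \<in> orbit p x"
      using 1[OF that] orbS[OF that] a by auto
  qed
qed

lemma cyc_insert_fixed:
  assumes "p permutes {1..n}"
  shows "cyc (Suc n) p = Suc (cyc n p)"
proof -
  have fixed: "p (Suc n) = Suc n"
    using permutes_not_in[OF assms] by simp
  have "orbit p (Suc n) = {Suc n}"
    by (simp add: fixed orbit_eq_singleton_iff)
  moreover have "{Suc n} \<notin> orbit p ` {1..n}"
  proof
    assume "{Suc n} \<in> orbit p ` {1..n}"
    then obtain x where "x \<in> {1..n}" "orbit p x = {Suc n}" by auto
    moreover have "p x \<in> orbit p x" by (rule orbit.base)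
    ultimately show False
      using permutes_in_image[OF assms, of x] by auto
  qed
  ultimately show ?thesis
    by (simp add: cyc_def atLeastAtMostSuc_conv)
qed

text \<open>Deleting \<open>Suc n\<close> from each orbit is a bijection from the orbits of the new
  permutation to those of \<open>p\<close>.\<close>

lemma cyc_insert:
  assumes p: "p permutes {1..n}" and b: "b \<in> {1..n}"
  shows "cyc (Suc n) (transpose (Suc n) b \<circ> p) = cyc n p"
proof -
  define f where "f = transpose (Suc n) b \<circ> p"
  have f: "f permutes {1..Suc n}"
    unfolding f_def
    by (intro permutes_compose permutes_swap_id permutes_subset[OF p]) (use b in auto)
  have perm: "permutation f"
    using f permutation_permutes by blast
  have fa: "f (Suc n) = b"
    using permutes_not_in[OF p] by (simp add: f_def)
  have "orbit f (Suc n) = orbit f b"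
    using permutation_orbit_step[OF perm, of "Suc n"] by (simp add: fa)
  then have "orbit f ` {1..Suc n} = orbit f ` {1..n}"
    using b by (auto simp: atLeastAtMostSuc_conv)
  \<comment> \<open>Orbits are equal or disjoint, and each of these keeps an element of
    \<open>{1..n}\<close> after the deletion.\<close>
  moreover have inj: "inj_on (\<lambda>T. T - {Suc n}) (orbit f ` {1..n})"
  proof (rule inj_onI, clarify)
    fix x y assume xy: "x \<in> {1..n}" "y \<in> {1..n}" and eq: "orbit f x - {Suc n} = orbit f y - {Suc n}"
    have "y \<in> orbit f y" using permutation_self_in_orbit[OF perm] .
    then have "y \<in> orbit f y - {Suc n}" using xy by simp
    then have "y \<in> orbit f x" unfolding eq[symmetric] by blast
    moreover from this have "x \<in> orbit f y"
      by (rule orbit_swap[OF permutation_self_in_orbit[OF perm]])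
    ultimately show "orbit f x = orbit f y"
      by (auto intro: orbit_trans)
  qed
  moreover have "(\<lambda>T. T - {Suc n}) ` orbit f ` {1..n} = orbit p ` {1..n}"
    unfolding image_image f_def
    by (intro image_cong refl orbit_insert_minus[OF p _ b]) auto
  ultimately show ?thesis
    unfolding cyc_def f_def[symmetric] using card_image[OF inj] by simp
qed

lemma exc_insert_fixed:
  assumes "p permutes {1..n}"
  shows "exc (Suc n) p = exc n p"
proof -
  have fixed: "p (Suc n) = Suc n"
    using permutes_not_in[OF assms] by simp
  have "{i \<in> {1..Suc n}. p i > i} = {i \<in> {1..n}. p i > i}"
    using fixed by (auto simp: le_Suc_eq)
  then show ?thesis by (simp add: exc_def)
qed

text \<open>With \<open>b = p i\<close> the new element lands between \<open>i\<close> and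
  \<open>p i\<close>: now \<open>i\<close> is an excedance, \<open>Suc n\<close> is not one, and no
  other index changes.\<close>

lemma exc_insert:
  assumes p: "p permutes {1..n}" and i: "i \<in> {1..n}"
  shows "exc (Suc n) (transpose (Suc n) (p i) \<circ> p) = (if p i > i then exc n p else Suc (exc n p))"
proof -
  define f where "f = transpose (Suc n) (p i) \<circ> p"
  have pi: "p i \<in> {1..n}" using permutes_in_image[OF p] i by blast
  have fa: "f (Suc n) = p i"
    using permutes_not_in[OF p] by (simp add: f_def)
  have fi: "f i = Suc n" by (simp add: f_def)
  have fo: "f y = p y" if "y \<in> {1..n}" "y \<noteq> i" for y
    using that permutes_in_image[OF p, of y] permutes_inj[OF p]
    by (auto simp: f_def transpose_def dest: injD)
  have "{j \<in> {1..Suc n}. f j > j} = insert i {j \<in> {1..n}. p j > j}"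
    (is "?L = ?R")
  proof (rule set_eqI)
    fix j
    show "j \<in> ?L \<longleftrightarrow> j \<in> ?R"
      using fa fi fo[of j] i pi by (cases "j = Suc n"; cases "j = i") auto
  qed
  then show ?thesis
    unfolding exc_def f_def[symmetric] using i by (auto simp: card_insert_if)
qed

text \<open>A permutation with \<open>e\<close> excedances and weight \<open>c\<close> extends in
  \<open>n + 1\<close> ways: a new fixed point multiplies \<open>c\<close> by \<open>q\<close>,
  \<open>e\<close> insertions keep \<open>e\<close>, and \<open>n - e\<close> raise it by one. The
  factors \<open>e\<close> come from the derivative.\<close>

lemma q_eulerian_Suc:
  "q_eulerian (Suc n) q =
     [:q, real n:] * q_eulerian n q + [:0, 1, -1:] * pderiv (q_eulerian n q)"
proof -
  let ?P = "{p. p permutes {1..n}}"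
  let ?m = "\<lambda>p. monom (q ^ cyc (Suc n) p) (exc (Suc n) p)"
  have ins: "{1..Suc n} = insert (Suc n) {1..n}" by auto
  have insertions: "(\<Sum>b\<in>{1..n}. ?m (transpose (Suc n) b \<circ> p)) + ?m p =
     [:q, real n:] * monom (q ^ cyc n p) (exc n p) + [:0, 1, -1:] * pderiv (monom (q ^ cyc n p) (exc n p))"
    if p: "p permutes {1..n}" for p
  proof -
    let ?c = "q ^ cyc n p" and ?e = "exc n p"
    have e: "?e \<le> n"
      unfolding exc_def by (rule order.trans[OF card_mono[of "{1..n}"]]) auto
    have "(\<Sum>b\<in>{1..n}. ?m (transpose (Suc n) b \<circ> p)) = (\<Sum>i\<in>{1..n}. ?m (transpose (Suc n) (p i) \<circ> p))"
      using sum.reindex_bij_betw[OF permutes_imp_bij[OF p], symmetric] by simp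
    also have "\<dots> = (\<Sum>i\<in>{1..n}. if p i > i then monom ?c ?e else monom ?c (Suc ?e))"
      using p permutes_in_image[OF p] by (intro sum.cong refl) (auto simp: exc_insert cyc_insert)
    also have "\<dots> = of_nat ?e * monom ?c ?e + of_nat (n - ?e) * monom ?c (Suc ?e)"
    proof -
      have "{1..n} \<inter> {i. p i > i} = {i \<in> {1..n}. p i > i}" by auto
      moreover have "card ({1..n} \<inter> - {i. p i > i}) = n - ?e"
        by (simp add: exc_def Diff_eq[symmetric] card_Diff_subset_Int calculation del: One_nat_def)
      ultimately show ?thesis
        by (simp add: sum.If_cases exc_def)
    qed
    finally have *: "(\<Sum>b\<in>{1..n}. ?m (transpose (Suc n) b \<circ> p)) =
      monom (real ?e * ?c) ?e + monom ((real n - real ?e) * ?c) (Suc ?e)"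
      using e by (simp add: of_nat_poly smult_monom of_nat_diff)
    have "?m p = monom (q * ?c) ?e"
      using p by (simp add: exc_insert_fixed cyc_insert_fixed)
    moreover have "[:q, real n:] * monom ?c ?e + [:0, 1, -1:] * pderiv (monom ?c ?e) =
       monom (q * ?c) ?e + (monom (real ?e * ?c) ?e + monom ((real n - real ?e) * ?c) (Suc ?e))"
      by (cases ?e)
         (simp_all add: poly_eq_poly_eq_iff[symmetric] fun_eq_iff poly_monom pderiv_monom algebra_simps)
    ultimately show ?thesis using * by simp
  qed
  \<comment> \<open>The term \<open>b = Suc n\<close> has the identity as its transposition and is
    the case of a new fixed point.\<close>
  have "q_eulerian (Suc n) q = (\<Sum>p\<in>?P. \<Sum>b\<in>insert (Suc n) {1..n}. ?m (transpose (Suc n) b \<circ> p))"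
    unfolding q_eulerian_eq_sum ins
    by (subst sum_over_permutations_insert; (rule sum.swap)?) auto
  also have "\<dots> = (\<Sum>p\<in>?P. [:q, real n:] * monom (q ^ cyc n p) (exc n p)
      + [:0, 1, -1:] * pderiv (monom (q ^ cyc n p) (exc n p)))"
    by (intro sum.cong refl) (subst insertions[symmetric], auto simp: add.commute)
  also have "\<dots> = [:q, real n:] * q_eulerian n q + [:0, 1, -1:] * pderiv (q_eulerian n q)"
    unfolding q_eulerian_eq_sum
    using sum_comp_morphism[of pderiv "\<lambda>p. monom (q ^ cyc n p) (exc n p)" ?P]
    by (simp only: sum.distrib sum_distrib_left[symmetric] pderiv_0 pderiv_add o_def)
  finally show ?thesis .
qed

section \<open>Logarithmic derivatives and the location of zeros\<close>

abbreviation cpoly :: "real poly \<Rightarrow> complex poly" where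
  "cpoly \<equiv> map_poly complex_of_real"

text \<open>A list keeps multiplicities, so that logarithmic derivatives are plain sums over
  it.\<close>

definition lin_prod :: "'a::comm_ring_1 list \<Rightarrow> 'a poly" where
  "lin_prod rs = (\<Prod>r\<leftarrow>rs. [:- r, 1:])"

lemma lin_prod_Nil [simp]: "lin_prod [] = 1"
  and lin_prod_Cons: "lin_prod (r # rs) = [:- r, 1:] * lin_prod rs"
  by (simp_all add: lin_prod_def)

lemma cpoly_add: "cpoly (p + r) = cpoly p + cpoly r"
  by (intro poly_eqI) (simp add: coeff_map_poly)

lemma cpoly_mult: "cpoly (p * r) = cpoly p * cpoly r"
  by (intro poly_eqI) (simp add: coeff_map_poly coeff_mult)

lemma cpoly_pCons: "cpoly (pCons a p) = pCons (complex_of_real a) (cpoly p)"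
  by (simp add: map_poly_pCons)

lemma cpoly_smult: "cpoly (smult a p) = smult (complex_of_real a) (cpoly p)"
  by (simp add: map_poly_smult)

lemma cpoly_pderiv: "cpoly (pderiv p) = pderiv (cpoly p)"
  by (intro poly_eqI) (simp add: coeff_map_poly coeff_pderiv)

lemma poly_cpoly_of_real: "poly (cpoly p) (complex_of_real x) = complex_of_real (poly p x)"
  by (induction p) (simp_all add: cpoly_pCons)

lemmas cpoly_simps = cpoly_add cpoly_mult cpoly_pCons cpoly_smult cpoly_pderiv

lemma lin_prod_nonzero [simp]: "lin_prod rs \<noteq> (0 :: 'a::idom poly)"
  by (induction rs) (simp_all add: lin_prod_Cons del: mult_pCons_left)

lemma degree_lin_prod [simp]: "degree (lin_prod rs :: 'a::idom poly) = length rs"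
  by (induction rs) (simp_all add: lin_prod_Cons degree_mult_eq del: mult_pCons_left)

lemma poly_lin_prod_eq_0_iff: "poly (lin_prod rs) x = 0 \<longleftrightarrow> x \<in> set rs" for x :: "'a::idom"
  by (induction rs) (auto simp: lin_prod_Cons simp del: mult_pCons_left)

lemma cpoly_lin_prod: "cpoly (lin_prod rs) = lin_prod (map complex_of_real rs)"
  by (induction rs) (simp_all add: lin_prod_Cons cpoly_mult cpoly_pCons del: mult_pCons_left)

lemma poly_pderiv_lin_prod:
  fixes x :: "'a::field"
  assumes "x \<notin> set rs"
  shows "poly (pderiv (lin_prod rs)) x = poly (lin_prod rs) x * (\<Sum>r\<leftarrow>rs. 1 / (x - r))"
  using assms
  by (induction rs)
     (simp_all add: lin_prod_Cons pderiv_mult pderiv_pCons field_simps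
        del: mult_pCons_left mult_pCons_right)

text \<open>A nonconstant polynomial has a complex zero; membership in \<open>RZ S\<close> makes it
  real, so a real linear factor splits off and the degree drops.\<close>

lemma RZ_splits:
  assumes "p \<in> RZ S"
  obtains c rs where "c \<noteq> 0" "set rs \<subseteq> S" "p = smult c (lin_prod rs)"
proof -
  have "\<exists>c rs. c \<noteq> 0 \<and> set rs \<subseteq> S \<and> p = smult c (lin_prod rs)"
    using assms
  proof (induction "degree p" arbitrary: p rule: less_induct)
    case less
    have "p \<noteq> 0" using less.prems zero_notin_RZ by metis
    show ?case
    proof (cases "degree p = 0")
      case True
      then obtain a where "p = [:a:]" using degree_eq_zeroE by blast
      with \<open>p \<noteq> 0\<close> show ?thesis
        by (intro exI[of _ a] exI[of _ "[]"]) simp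
    next
      case False
      then have "degree (cpoly p) \<noteq> 0" by (simp add: degree_map_poly)
      then obtain z where z: "poly (cpoly p) z = 0"
        using fundamental_theorem_of_algebra[of "cpoly p"] constant_degree[of "cpoly p"] by auto
      then obtain x where x: "x \<in> S" "z = complex_of_real x"
        using less.prems by (auto simp: RZ_def)
      then have "poly p x = 0" using z by (simp add: poly_cpoly_of_real)
      then obtain r where r: "p = [:- x, 1:] * r"
        by (auto simp: poly_eq_0_iff_dvd)
      have "r \<noteq> 0" using r \<open>p \<noteq> 0\<close> by auto
      then have "degree r < degree p" using r by (simp add: degree_mult_eq del: mult_pCons_left)
      moreover have "r \<in> RZ S"
        using less.prems by (auto simp: RZ_def r cpoly_mult simp del: mult_pCons_left)
      ultimately obtain c rs where "c \<noteq> 0" "set rs \<subseteq> S" "r = smult c (lin_prod rs)"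
        using less.hyps by blast
      then show ?thesis using r x
        by (intro exI[of _ c] exI[of _ "x # rs"]) (simp add: lin_prod_Cons)
    qed
  qed
  then show ?thesis using that by blast
qed


section \<open>Zeros of one recurrence step\<close>

lemma Im_div_diff:
  "Im (z / (z - complex_of_real r)) = - Im z * (r / (cmod (z - complex_of_real r))\<^sup>2)"
  by (simp add: Im_divide cmod_power2 algebra_simps diff_divide_distrib)

lemma Im_pred_div_diff:
  "Im ((z - 1) / (z - complex_of_real r)) = Im z * ((1 - r) / (cmod (z - complex_of_real r))\<^sup>2)"
  by (simp add: Im_divide cmod_power2 algebra_simps diff_divide_distrib)

lemma Im_complex_of_real_mult: "Im (complex_of_real w * z) = w * Im z"
  by simp

lemma Im_sum_list: "Im (\<Sum>x\<leftarrow>xs. f x) = (\<Sum>x\<leftarrow>xs. Im (f x))"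
  by (induction xs) auto

lemma of_real_sum_list: "complex_of_real (\<Sum>x\<leftarrow>xs. f x) = (\<Sum>x\<leftarrow>xs. complex_of_real (f x))"
  by (induction xs) auto

text \<open>For nonreal \<open>z\<close> the imaginary parts have a common sign and sum to 0, so all
  weights vanish and both sides of \<open>less\<close> are 0. For real \<open>z \<le> 1\<close> each
  quotient is at most 1, so the sum stays below \<open>s\<close>.\<close>

lemma weighted_sum_eq_imp_real:
  fixes ws :: "(real \<times> real) list"
  assumes ws: "\<And>w r. (w, r) \<in> set ws \<Longrightarrow> 0 \<le> w \<and> 1 \<le> r"
    and z: "z \<notin> complex_of_real ` snd ` set ws"
    and eq: "(\<Sum>(w, r)\<leftarrow>ws. complex_of_real w * (z / (z - complex_of_real r))) = complex_of_real s"
    and less: "(\<Sum>(w, r)\<leftarrow>ws. w) < s"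
  shows "z \<in> complex_of_real ` {1<..}"
proof -
  have "Im z = 0"
  proof (rule ccontr)
    assume "Im z \<noteq> 0"
    define t where "t x = fst x * (snd x / (cmod (z - complex_of_real (snd x)))\<^sup>2)"
      for x :: "real \<times> real"
    have "0 = (\<Sum>x\<leftarrow>ws. Im (case x of (w, r) \<Rightarrow> complex_of_real w * (z / (z - complex_of_real r))))"
      using arg_cong[OF eq, of Im] by (simp only: Im_sum_list Im_complex_of_real)
    also have "\<dots> = (\<Sum>x\<leftarrow>ws. - Im z * t x)"
      by (intro arg_cong[where f = sum_list] map_cong refl)
         (simp only: split_beta Im_complex_of_real_mult Im_div_diff mult_ac t_def)
    also have "\<dots> = - Im z * (\<Sum>x\<leftarrow>ws. t x)"
      by (rule sum_list_const_mult)
    finally have "(\<Sum>x\<leftarrow>ws. t x) = 0" using \<open>Im z \<noteq> 0\<close> by simp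
    moreover have "0 \<le> t x" if "x \<in> set ws" for x
      using ws[of "fst x" "snd x"] that by (simp add: t_def)
    ultimately have "\<forall>y\<in>set (map t ws). y = 0"
      by (subst sum_list_nonneg_eq_0_iff[symmetric]) auto
    then have t0: "t x = 0" if "x \<in> set ws" for x using that by simp
    have w0: "w = 0" if "(w, r) \<in> set ws" for w r
    proof -
      have "z \<noteq> complex_of_real r" using z that by force
      then show ?thesis using t0[OF that] ws[OF that] by (simp add: t_def)
    qed
    have "(\<Sum>(w, r)\<leftarrow>ws. complex_of_real w * (z / (z - complex_of_real r))) = (\<Sum>x\<leftarrow>ws. 0)"
      and "(\<Sum>(w, r)\<leftarrow>ws. w) = (\<Sum>x\<leftarrow>ws. 0)"
      using w0 by (intro arg_cong[where f = sum_list] map_cong refl; force)+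
    then show False using eq less by simp
  qed
  then obtain x where x: "z = complex_of_real x"
    by (metis complex_is_Real_iff Reals_cases)
  have "x > 1"
  proof (rule ccontr)
    assume "\<not> x > 1"
    have "complex_of_real s = complex_of_real (\<Sum>(w, r)\<leftarrow>ws. w * (x / (x - r)))"
      unfolding eq[symmetric] x by (simp add: of_real_sum_list case_prod_unfold)
    then have "s = (\<Sum>(w, r)\<leftarrow>ws. w * (x / (x - r)))"
      by (simp only: of_real_eq_iff)
    also have "\<dots> \<le> (\<Sum>(w, r)\<leftarrow>ws. w)"
    proof (rule sum_list_mono, clarify)
      fix w r assume wr: "(w, r) \<in> set ws"
      then have "x \<noteq> r" using z x by force
      then have "x < r" using ws[OF wr] \<open>\<not> x > 1\<close> by auto
      then have "x / (x - r) \<le> 1" using ws[OF wr] by (simp add: field_simps)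
      then show "w * (x / (x - r)) \<le> w" using ws[OF wr] mult_left_le by blast
    qed
    finally show False using less by simp
  qed
  then show ?thesis using x by auto
qed

text \<open>The recurrence as an operator on arbitrary polynomials, with \<open>j\<close> in the
  place of the index.\<close>

definition euler_step :: "real \<Rightarrow> nat \<Rightarrow> real poly \<Rightarrow> real poly" where
  "euler_step q j p = [:q, real j:] * p + [:0, 1, -1:] * pderiv p"

lemma cpoly_euler_step:
  "poly (cpoly (euler_step q j p)) z =
    (complex_of_real q + of_nat j * z) * poly (cpoly p) z + z * (1 - z) * poly (pderiv (cpoly p)) z"
  unfolding euler_step_def cpoly_simps by (simp add: algebra_simps)

text \<open>Away from 1 and the zeros of \<open>p\<close>, a zero of the step satisfies a weighted
  identity with right side \<open>- q\<close>. At 1 the step has the value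
  \<open>(j + q) p(1)\<close>, so 1 is a zero exactly when \<open>j + q = 0\<close>.\<close>

lemma euler_step_RZ_ge_1:
  assumes p: "p \<in> RZ {1<..}" and deg: "degree p < j" and q: "real j + q \<le> 0"
  shows "euler_step q j p \<in> RZ {1..}"
    and "real j + q \<noteq> 0 \<Longrightarrow> euler_step q j p \<in> RZ {1<..}"
proof -
  obtain c rs where c: "c \<noteq> 0" and rs: "set rs \<subseteq> {1<..}" and p_eq: "p = smult c (lin_prod rs)"
    using RZ_splits[OF p] .
  have "q < 0" using q deg by linarith
  have "z \<in> complex_of_real ` {1<..}"
    if root: "poly (cpoly (euler_step q j p)) z = 0" and z1: "real j + q = 0 \<longrightarrow> z \<noteq> 1" for z
  proof (cases "poly (cpoly p) z = 0")
    case True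
    then show ?thesis using p by (auto simp: RZ_def)
  next
    case False
    define rs' where "rs' = map complex_of_real rs"
    have zrs: "z \<notin> set rs'"
      using False c by (auto simp: p_eq cpoly_smult cpoly_lin_prod poly_lin_prod_eq_0_iff rs'_def)
    have "z \<noteq> 0" using root False \<open>q < 0\<close> by (auto simp: cpoly_euler_step)
    have "z \<noteq> 1"
    proof
      assume "z = 1"
      then have "of_nat j + complex_of_real q = 0"
        using root False by (auto simp: cpoly_euler_step add.commute)
      then have "complex_of_real (real j + q) = 0" by simp
      then show False using z1 \<open>z = 1\<close> of_real_eq_0_iff by blast
    qed
    let ?L = "\<Sum>r\<leftarrow>rs'. 1 / (z - r)"
    \<comment> \<open>The pole at 1 has weight \<open>- (j + q) \<ge> 0\<close>, each zero of
      \<open>p\<close> weight 1. The total is below \<open>- q\<close> because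
      \<open>degree p < j\<close>.\<close>
    let ?ws = "(- (real j + q), 1) # map (Pair 1) rs"
    have "poly (pderiv (cpoly p)) z = poly (cpoly p) z * ?L"
      using poly_pderiv_lin_prod[OF zrs]
      by (simp add: p_eq cpoly_smult cpoly_lin_prod pderiv_smult rs'_def)
    then have "(complex_of_real q + of_nat j * z + z * (1 - z) * ?L) * poly (cpoly p) z = 0"
      using root by (simp add: cpoly_euler_step algebra_simps)
    then have eq: "complex_of_real q + of_nat j * z + z * (1 - z) * ?L = 0" using False by simp
    have sumw: "(\<Sum>(w, r)\<leftarrow>?ws. complex_of_real w * (z / (z - complex_of_real r))) =
        - (of_nat j + complex_of_real q) * (z / (z - 1)) + z * ?L"
      by (simp add: o_def rs'_def flip: sum_list_const_mult)
    also have "\<dots> = complex_of_real (- q)"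
      using eq \<open>z \<noteq> 1\<close> by (simp add: field_simps)
    finally have sum_eq: "(\<Sum>(w, r)\<leftarrow>?ws. complex_of_real w * (z / (z - complex_of_real r))) = complex_of_real (- q)" .
    show ?thesis
    proof (rule weighted_sum_eq_imp_real[OF _ _ sum_eq])
      show "0 \<le> w \<and> 1 \<le> r" if "(w, r) \<in> set ?ws" for w r
        using that q rs by auto
      show "z \<notin> complex_of_real ` snd ` set ?ws"
        using zrs \<open>z \<noteq> 1\<close> by (auto simp: rs'_def)
      have "length rs < j" using deg c by (simp add: p_eq)
      then show "(\<Sum>(w, r)\<leftarrow>?ws. w) < - q"
        by (simp add: o_def sum_list_triv)
    qed
  qed
  then show "euler_step q j p \<in> RZ {1..}" and "real j + q \<noteq> 0 \<Longrightarrow> euler_step q j p \<in> RZ {1<..}"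
    unfolding RZ_def by force+
qed

text \<open>Nonreal zeros fail by a comparison of imaginary parts, positive ones by
  \<open>pos\<close>, and 0 because the value there is \<open>q p(0)\<close>. Simplicity follows
  from the factorization \<open>- y p(y) G(y)\<close> with \<open>G\<close> increasing at each zero
  of the step.\<close>

lemma euler_step_RZ_less_0:
  assumes p: "p \<in> RZ {..<0}" and simple: "\<And>x. poly p x = 0 \<Longrightarrow> poly (pderiv p) x \<noteq> 0"
    and q: "q > 0" and pos: "\<And>x. x > 0 \<Longrightarrow> poly (euler_step q j p) x > 0"
  shows "euler_step q j p \<in> RZ {..<0}"
    and "poly (euler_step q j p) x = 0 \<Longrightarrow> poly (pderiv (euler_step q j p)) x \<noteq> 0"
proof -
  obtain c rs where c: "c \<noteq> 0" and rs: "set rs \<subseteq> {..<0}" and p_eq: "p = smult c (lin_prod rs)"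
    using RZ_splits[OF p] .
  have poly_step: "poly (euler_step q j p) x = (q + real j * x) * poly p x + x * (1 - x) * poly (pderiv p) x" for x
    by (simp add: euler_step_def algebra_simps)
  \<comment> \<open>At a zero of \<open>p\<close> the step equals \<open>x (1 - x) p'(x)\<close>,
    which is nonzero because \<open>x < 0\<close> and the zero is simple.\<close>
  have nz: "poly p x \<noteq> 0" "x < 0" if "poly (euler_step q j p) x = 0" for x
  proof -
    show "poly p x \<noteq> 0"
    proof
      assume x: "poly p x = 0"
      then have "x < 0"
        using rs c by (auto simp: p_eq poly_lin_prod_eq_0_iff)
      then show False using simple[OF x] x that by (simp add: poly_step)
    qed
    then have "x \<noteq> 0" using that q by (auto simp: poly_step)
    then show "x < 0" using pos[of x] that by force
  qed
  show "euler_step q j p \<in> RZ {..<0}"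
    unfolding RZ_def
  proof (intro CollectI allI impI)
    fix z assume root: "poly (cpoly (euler_step q j p)) z = 0"
    have "Im z = 0"
    proof (rule ccontr)
      assume Im: "Im z \<noteq> 0"
      define rs' where "rs' = map complex_of_real rs"
      have "z \<noteq> 0" using Im by auto
      have zrs: "z \<notin> set rs'" using Im by (auto simp: rs'_def)
      let ?L = "\<Sum>r\<leftarrow>rs'. 1 / (z - r)"
      have pz: "poly (cpoly p) z \<noteq> 0"
        using zrs c by (simp add: p_eq cpoly_smult cpoly_lin_prod poly_lin_prod_eq_0_iff rs'_def)
      have "poly (pderiv (cpoly p)) z = poly (cpoly p) z * ?L"
        using poly_pderiv_lin_prod[OF zrs]
        by (simp add: p_eq cpoly_smult cpoly_lin_prod pderiv_smult rs'_def)
      then have "(complex_of_real q + of_nat j * z + z * (1 - z) * ?L) * poly (cpoly p) z = 0"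
        using root by (simp add: cpoly_euler_step algebra_simps)
      then have eq: "complex_of_real q + of_nat j * z + z * (1 - z) * ?L = 0" using pz by simp
      let ?ws = "(q, 0) # map (Pair 1) rs"
      have "(\<Sum>(w, r)\<leftarrow>?ws. complex_of_real w * ((z - 1) / (z - complex_of_real r))) =
          complex_of_real q * ((z - 1) / z) + (z - 1) * ?L"
        by (simp add: o_def rs'_def flip: sum_list_const_mult)
      also have "\<dots> = complex_of_real (real j + q)"
        using eq \<open>z \<noteq> 0\<close> by (simp add: field_simps)
      finally have "0 = (\<Sum>x\<leftarrow>?ws. Im (case x of (w, r) \<Rightarrow> complex_of_real w * ((z - 1) / (z - complex_of_real r))))"
        by (metis Im_complex_of_real Im_sum_list)
      also have "\<dots> = (\<Sum>x\<leftarrow>?ws. Im z * (fst x * ((1 - snd x) / (cmod (z - complex_of_real (snd x)))\<^sup>2)))"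
        by (intro arg_cong[where f = sum_list] map_cong refl)
           (simp only: split_beta Im_complex_of_real_mult Im_pred_div_diff mult_ac)
      also have "\<dots> = Im z * (\<Sum>x\<leftarrow>?ws. fst x * ((1 - snd x) / (cmod (z - complex_of_real (snd x)))\<^sup>2))"
        by (rule sum_list_const_mult)
      finally have "(\<Sum>x\<leftarrow>?ws. fst x * ((1 - snd x) / (cmod (z - complex_of_real (snd x)))\<^sup>2)) = 0"
        using Im by simp
      moreover have "0 \<le> (\<Sum>x\<leftarrow>map (Pair 1) rs. fst x * ((1 - snd x) / (cmod (z - complex_of_real (snd x)))\<^sup>2))"
        using rs by (intro sum_list_nonneg) (auto intro!: divide_nonneg_nonneg)
      \<comment> \<open>The pole at 0 makes the sum strictly positive, even when \<open>rs\<close>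
        is empty.\<close>
      moreover have "q * (1 / (cmod z)\<^sup>2) > 0" using q \<open>z \<noteq> 0\<close> by simp
      ultimately show False by simp
    qed
    then obtain x where x: "z = complex_of_real x"
      by (metis complex_is_Real_iff Reals_cases)
    then show "z \<in> complex_of_real ` {..<0}"
      using nz(2)[of x] root by (auto simp: poly_cpoly_of_real)
  qed
  show "poly (pderiv (euler_step q j p)) x \<noteq> 0" if root: "poly (euler_step q j p) x = 0"
  proof -
    define G where "G y = q * ((y - 1) / y) - (real j + q) + (\<Sum>r\<leftarrow>rs. (y - 1) / (y - r))" for y
    define G' where "G' = q / x\<^sup>2 + (\<Sum>r\<leftarrow>rs. (1 - r) / (x - r)\<^sup>2)"
    have "x < 0" and px: "poly p x \<noteq> 0" using nz[OF root] by auto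
    then have x: "x \<in> - insert 0 (set rs)"
      using c by (auto simp: p_eq poly_lin_prod_eq_0_iff)
    have factor: "poly (euler_step q j p) y = - y * poly p y * G y"
      if "y \<in> - insert 0 (set rs)" for y
    proof -
      have "poly (pderiv p) y = poly p y * (\<Sum>r\<leftarrow>rs. 1 / (y - r))"
        using poly_pderiv_lin_prod[of y rs] that by (simp add: p_eq pderiv_smult)
      moreover have Gy: "G y = q * ((y - 1) / y) - (real j + q) + (y - 1) * (\<Sum>r\<leftarrow>rs. 1 / (y - r))"
        by (simp add: G_def flip: sum_list_const_mult)
      moreover have "y * G y = q * (y - 1) - (real j + q) * y + y * (y - 1) * (\<Sum>r\<leftarrow>rs. 1 / (y - r))"
        unfolding Gy using that by (simp add: field_simps)
      moreover have "- y * poly p y * G y = - (poly p y * (y * G y))" by simp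
      ultimately show ?thesis
        by (simp only: poly_step) (simp add: algebra_simps)
    qed
    have DG_sum: "((\<lambda>y. \<Sum>r\<leftarrow>rs. (y - 1) / (y - r)) has_field_derivative (\<Sum>r\<leftarrow>rs. (1 - r) / (x - r)\<^sup>2)) (at x)"
      if "x \<notin> set rs" for rs :: "real list"
      using that
    proof (induction rs)
      case (Cons r rs)
      have "((\<lambda>y. (y - 1) / (y - r)) has_field_derivative (1 - r) / (x - r)\<^sup>2) (at x)"
        using Cons.prems by (auto intro!: derivative_eq_intros simp: power2_eq_square)
      then show ?case using Cons by (auto intro: DERIV_add)
    qed simp
    have DG: "(G has_field_derivative G') (at x)"
      unfolding G_def G'_def using x
      by (auto intro!: derivative_eq_intros DG_sum simp: power2_eq_square right_diff_distrib)
    have "G x = 0" using factor[OF x] root x px by auto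
    \<comment> \<open>Since \<open>G x = 0\<close>, only the term with \<open>G'\<close> survives in
      the product rule.\<close>
    have "((\<lambda>y. - y * poly p y * G y) has_field_derivative - x * poly p x * G') (at x)"
      by (rule derivative_eq_intros DG poly_DERIV refl)+ (simp add: \<open>G x = 0\<close>)
    \<comment> \<open>The factorization is known only off 0 and the zeros of \<open>p\<close>, an
      open set containing \<open>x\<close>.\<close>
    then have "(poly (euler_step q j p) has_field_derivative - x * poly p x * G') (at x)"
      by (rule has_field_derivative_transform_within_open[where S = "- insert 0 (set rs)"])
         (use factor x in \<open>auto intro: finite_imp_closed\<close>)
    then have "poly (pderiv (euler_step q j p)) x = - x * poly p x * G'"
      using poly_DERIV DERIV_unique by blast
    moreover have "G' > 0"
      unfolding G'_def using q \<open>x < 0\<close> rs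
      by (intro add_pos_nonneg sum_list_nonneg) (auto intro!: divide_nonneg_nonneg)
    ultimately show ?thesis using x px by simp
  qed
qed

text \<open>All complex zeros are real, so the real derivative test settles their complex
  order.\<close>

lemma simple_zerosI:
  assumes p: "p \<in> RZ S" and simple: "\<And>x. poly p x = 0 \<Longrightarrow> poly (pderiv p) x \<noteq> 0"
  shows "simple_zeros p"
  unfolding simple_zeros_def
proof (intro allI impI)
  fix z assume z: "poly (cpoly p) z = 0"
  then obtain x where x: "z = complex_of_real x" using p by (auto simp: RZ_def)
  have "cpoly p \<noteq> 0" using p zero_notin_RZ by (auto simp: map_poly_eq_0_iff)
  moreover have "poly (pderiv (cpoly p)) z \<noteq> 0"
    using simple[of x] z by (simp add: x poly_cpoly_of_real flip: cpoly_pderiv)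
  ultimately show "order z (cpoly p) = 1"
    using order_pderiv[of "cpoly p" z] z by (simp add: order_0I)
qed

lemma const_RZ: "a \<noteq> 0 \<Longrightarrow> [:a:] \<in> RZ S"
  by (simp add: RZ_def cpoly_pCons)

lemma RZ_mono: "p \<in> RZ S \<Longrightarrow> S \<subseteq> T \<Longrightarrow> p \<in> RZ T"
  by (auto simp: RZ_def)

lemma RZ_mult: "p \<in> RZ S \<Longrightarrow> r \<in> RZ S \<Longrightarrow> p * r \<in> RZ S"
  by (auto simp: RZ_def cpoly_mult)

lemma RZ_poly_neq_0: "p \<in> RZ S \<Longrightarrow> x \<notin> S \<Longrightarrow> poly p x \<noteq> 0"
  using poly_cpoly_of_real[of p x] by (auto simp: RZ_def)

lemma RZ_linear: "x \<in> S \<Longrightarrow> [:- x, 1:] \<in> RZ S"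
  by (auto simp: RZ_def cpoly_pCons add_eq_0_iff)

lemma one_RZ: "1 \<in> RZ S"
  by (simp add: RZ_def)

lemma RZ_power: "p \<in> RZ S \<Longrightarrow> p ^ k \<in> RZ S"
  by (induction k) (simp_all add: one_RZ RZ_mult)

section \<open>The cofactor of the power of x - 1 for negative integer q\<close>

definition lower_step :: "nat \<Rightarrow> real poly \<Rightarrow> real poly" where
  "lower_step m p = smult (real m) p - [:0, 1:] * pderiv p"

lemma degree_lower_step: "degree p < m \<Longrightarrow> degree (lower_step m p) < m"
  unfolding lower_step_def
  by (rule degree_diff_less)
     (auto intro: le_less_trans[OF degree_smult_le] simp: degree_pCons_eq_if degree_pderiv pderiv_eq_0_iff)

text \<open>A zero of \<open>m p - x p'\<close> that is not a zero of \<open>p\<close> makes the sum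
  of \<open>z / (z - r)\<close> equal to \<open>m\<close>, while the total weight is only
  \<open>degree p < m\<close>.\<close>

lemma lower_step_RZ_gt_1:
  assumes p: "p \<in> RZ {1<..}" and deg: "degree p < m"
  shows "lower_step m p \<in> RZ {1<..}"
  unfolding RZ_def
proof (intro CollectI allI impI)
  fix z assume root: "poly (cpoly (lower_step m p)) z = 0"
  obtain c rs where c: "c \<noteq> 0" and rs: "set rs \<subseteq> {1<..}" and p_eq: "p = smult c (lin_prod rs)"
    using RZ_splits[OF p] .
  have "lower_step m p = smult (real m) p + [:0, -1:] * pderiv p"
    by (simp add: lower_step_def)
  then have "poly (cpoly (lower_step m p)) z =
      of_nat m * poly (cpoly p) z - z * poly (pderiv (cpoly p)) z"
    by (simp only: cpoly_simps) simp
  with root have root': "of_nat m * poly (cpoly p) z - z * poly (pderiv (cpoly p)) z = 0" by simp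
  show "z \<in> complex_of_real ` {1<..}"
  proof (cases "poly (cpoly p) z = 0")
    case True
    then show ?thesis using p by (auto simp: RZ_def)
  next
    case False
    define rs' where "rs' = map complex_of_real rs"
    have zrs: "z \<notin> set rs'"
      using False c by (auto simp: p_eq cpoly_smult cpoly_lin_prod poly_lin_prod_eq_0_iff rs'_def)
    let ?L = "\<Sum>r\<leftarrow>rs'. 1 / (z - r)"
    let ?ws = "map (Pair (1::real)) rs"
    have "poly (pderiv (cpoly p)) z = poly (cpoly p) z * ?L"
      using poly_pderiv_lin_prod[OF zrs]
      by (simp add: p_eq cpoly_smult cpoly_lin_prod pderiv_smult rs'_def)
    then have "z * ?L = of_nat m"
      using root' False by (simp add: algebra_simps)
    then have sum_eq: "(\<Sum>(w, r)\<leftarrow>?ws. complex_of_real w * (z / (z - complex_of_real r))) = complex_of_real (real m)"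
      by (simp add: o_def rs'_def flip: sum_list_const_mult)
    show ?thesis
    proof (rule weighted_sum_eq_imp_real[OF _ _ sum_eq])
      show "0 \<le> w \<and> 1 \<le> r" if "(w, r) \<in> set ?ws" for w r
        using that rs by auto
      show "z \<notin> complex_of_real ` snd ` set ?ws"
        using zrs by (auto simp: rs'_def)
      show "(\<Sum>(w, r)\<leftarrow>?ws. w) < real m"
        using deg c by (simp add: p_eq o_def sum_list_triv)
    qed
  qed
qed

text \<open>At \<open>q = -m\<close> the coefficient \<open>j x + q\<close> with \<open>j = m + k\<close> equals
  \<open>m (x - 1) + k x\<close>, and the term \<open>k x\<close> cancels against the derivative of \<open>(x - 1)^k\<close>.\<close>

lemma euler_step_power:
  "euler_step (- real m) (m + k) ([:-1, 1:] ^ k * p) = [:-1, 1:] ^ Suc k * lower_step m p"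
proof -
  \<comment> \<open>The exponent \<open>k - 1\<close> truncates at \<open>k = 0\<close>, where the
    factor \<open>real k\<close> vanishes.\<close>
  have *: "(1 - x) * (real k * (x - 1) ^ (k - 1)) = - real k * (x - 1) ^ k" for x :: real
    by (cases k) (simp_all add: algebra_simps)
  show ?thesis
  proof (rule poly_eq_poly_eq_iff[THEN iffD1], rule ext)
    fix x :: real
    have "poly (euler_step (- real m) (m + k) ([:-1, 1:] ^ k * p)) x =
      (- real m + real (m + k) * x) * (x - 1) ^ k * poly p x +
      x * ((1 - x) * (real k * (x - 1) ^ (k - 1))) * poly p x
      + x * (1 - x) * (x - 1) ^ k * poly (pderiv p) x"
      by (simp add: euler_step_def pderiv_mult pderiv_power pderiv_pCons algebra_simps)
    also have "\<dots> = poly ([:-1, 1:] ^ Suc k * lower_step m p) x"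
      unfolding * by (simp add: lower_step_def algebra_simps)
    finally show "poly (euler_step (- real m) (m + k) ([:-1, 1:] ^ k * p)) x =
      poly ([:-1, 1:] ^ Suc k * lower_step m p) x" .
  qed
qed

lemma degree_euler_step: "degree p < j \<Longrightarrow> degree (euler_step q j p) \<le> j"
proof (cases "degree p = 0")
  case True
  then obtain a where "p = [:a:]" using degree_eq_zeroE by blast
  moreover assume "degree p < j"
  ultimately show ?thesis by (simp add: euler_step_def degree_pCons_eq_if)
next
  case False
  moreover assume "degree p < j"
  ultimately show ?thesis
    unfolding euler_step_def
    by (intro degree_add_le order.trans[OF degree_mult_le]) (auto simp: degree_pderiv)
qed

section \<open>Zeros of the q-Eulerian polynomials\<close>

lemma q_eulerian_0: "q_eulerian 0 q = 1"
  by (simp add: q_eulerian_def)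

lemma q_eulerian_Suc_step: "q_eulerian (Suc n) q = euler_step q n (q_eulerian n q)"
  by (simp only: q_eulerian_Suc euler_step_def)

lemma q_eulerian_1: "q_eulerian (Suc 0) q = [:q:]"
  by (simp add: q_eulerian_Suc_step q_eulerian_0 euler_step_def)

text \<open>Supplies the bound \<open>degree p < j\<close> for the steps from index 1 on; at index 0
  it would fail.\<close>

lemma degree_q_eulerian: "degree (q_eulerian (Suc n) q) < Suc n"
proof (induction n)
  case (Suc n)
  then show ?case
    using degree_euler_step by (simp add: q_eulerian_Suc_step[of "Suc n"] less_Suc_eq_le)
qed (simp add: q_eulerian_1)

lemma q_eulerian_pos:
  assumes "q > 0" "x > 0"
  shows "poly (q_eulerian n q) x > 0"
  unfolding q_eulerian_eq_sum poly_sum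
proof (rule sum_pos)
  show "{\<pi>. \<pi> permutes {1..n}} \<noteq> {}"
    using permutes_id by blast
qed (use assms in \<open>auto simp: poly_monom finite_permutations\<close>)

text \<open>Location and simplicity go through one induction, since simplicity at index
  \<open>n\<close> locates the zeros at \<open>n + 1\<close>.\<close>

lemma q_eulerian_RZ_less_0:
  assumes "q > 0"
  shows "q_eulerian n q \<in> RZ {..<0} \<and>
    (\<forall>x. poly (q_eulerian n q) x = 0 \<longrightarrow> poly (pderiv (q_eulerian n q)) x \<noteq> 0)"
proof (induction n)
  case 0
  show ?case by (simp add: q_eulerian_0 one_RZ)
next
  case (Suc n)
  then have *: "q_eulerian n q \<in> RZ {..<0}"
      "\<And>x. poly (q_eulerian n q) x = 0 \<Longrightarrow> poly (pderiv (q_eulerian n q)) x \<noteq> 0" by auto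
  have pos: "\<And>x. x > 0 \<Longrightarrow> poly (euler_step q n (q_eulerian n q)) x > 0"
    using q_eulerian_pos[OF assms, of _ "Suc n"] by (simp only: q_eulerian_Suc_step)
  show ?case
    unfolding q_eulerian_Suc_step
    using euler_step_RZ_less_0[OF * assms pos] by blast
qed

text \<open>The strict inequality passes to all smaller indices, so no step in the induction creates
  a zero at 1.\<close>

lemma q_eulerian_RZ_gt_1:
  assumes "real n + q < 0"
  shows "q_eulerian (Suc n) q \<in> RZ {1<..}"
  using assms
proof (induction n)
  case 0
  then show ?case by (simp add: q_eulerian_1 const_RZ)
next
  case (Suc n)
  then show ?case
    using euler_step_RZ_ge_1(2)[OF _ degree_q_eulerian, where q = q]
    by (simp add: q_eulerian_Suc_step[of "Suc n"])
qed

text \<open>From index \<open>m\<close> on, each step gains one factor \<open>x - 1\<close> and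
  applies \<open>lower_step\<close> to the cofactor.\<close>

lemma q_eulerian_neg:
  "q_eulerian (m + k) (- real m) = [:-1, 1:] ^ k * (lower_step m ^^ k) (q_eulerian m (- real m))"
proof (induction k)
  case 0
  show ?case by simp
next
  case (Suc k)
  have "q_eulerian (m + Suc k) (- real m) = euler_step (- real m) (m + k) (q_eulerian (m + k) (- real m))"
    unfolding add_Suc_right by (rule q_eulerian_Suc_step)
  also have "\<dots> = [:-1, 1:] ^ Suc k * lower_step m ((lower_step m ^^ k) (q_eulerian m (- real m)))"
    unfolding Suc.IH by (rule euler_step_power)
  finally show ?case by (simp only: funpow.simps o_apply)
qed

lemma exact_pow_dvd_mult:
  assumes "poly p a \<noteq> 0"
  shows "exact_pow_dvd a k ([:- a, 1:] ^ k * p)"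
proof -
  have "\<not> [:- a, 1:] ^ k * [:- a, 1:] dvd [:- a, 1:] ^ k * p"
    using assms by (subst dvd_mult_cancel_left) (simp add: poly_eq_0_iff_dvd)
  then show ?thesis
    by (simp only: exact_pow_dvd_def power_add power_one_right dvd_triv_left simp_thms)
qed

lemma q_eulerian_neg_int:
  assumes "m > 0"
  shows "q_eulerian n (- real m) \<in> RZ {1..} \<and>
    exact_pow_dvd 1 (n - m) (q_eulerian n (- real m))"
proof -
  have low: "q_eulerian n (- real m) \<in> RZ {1<..}" if "n \<le> m" for n
  proof (cases n)
    case 0
    then show ?thesis by (simp add: q_eulerian_0 one_RZ)
  next
    case (Suc l)
    then show ?thesis using that by (auto intro: q_eulerian_RZ_gt_1)
  qed
  \<comment> \<open>The degree bound is carried along because each application of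
    \<open>lower_step_RZ_gt_1\<close> needs it.\<close>
  have iter: "(lower_step m ^^ k) (q_eulerian m (- real m)) \<in> RZ {1<..} \<and>
      degree ((lower_step m ^^ k) (q_eulerian m (- real m))) < m" for k
  proof (induction k)
    case 0
    then show ?case using low[of m] degree_q_eulerian[of "m - 1"] assms by simp
  next
    case (Suc k)
    then show ?case using lower_step_RZ_gt_1 degree_lower_step by simp
  qed
  \<comment> \<open>Truncated subtraction covers \<open>n \<le> m\<close> with exponent 0. As
    \<open>p\<close> has no zero at 1, the exponent is exact.\<close>
  have "\<exists>p \<in> RZ {1<..}. q_eulerian n (- real m) = [:-1, 1:] ^ (n - m) * p"
  proof (cases "n \<le> m")
    case True
    then show ?thesis using low by auto
  next
    case False
    then show ?thesis using iter q_eulerian_neg[of m "n - m"] by auto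
  qed
  then obtain p where p: "p \<in> RZ {1<..}" "q_eulerian n (- real m) = [:-1, 1:] ^ (n - m) * p"
    by blast
  moreover have "[:-1, 1:] ^ (n - m) * p \<in> RZ {1..}"
    using RZ_mono[OF p(1), of "{1..}"] RZ_linear[of 1 "{1..}"] by (simp add: RZ_mult RZ_power subset_iff)
  ultimately show ?thesis
    using exact_pow_dvd_mult[of p 1 "n - m"] RZ_poly_neq_0[OF p(1), of 1] by simp
qed

text \<open>The case \<open>n = 0\<close>, \<open>q = 0\<close> is excluded in the second claim
  because \<open>q_eulerian 1 0\<close> is the zero polynomial, which lies in no
  \<open>RZ S\<close>. The last claim starts at \<open>n = 1\<close>, since at \<open>n = 0\<close>
  its sides would be 1 and -1.\<close>

theorem proposition4:
  fixes q :: real and n :: nat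
  shows "(q > 0 \<and> n \<ge> 2 \<longrightarrow> q_eulerian n q \<in> RZ {..0} \<and> simple_zeros (q_eulerian n q)) \<and>
    (real n + q \<le> 0 \<and> \<not> (n = 0 \<and> q = 0) \<longrightarrow> q_eulerian (n + 1) q \<in> RZ {1..}) \<and>
    (\<forall>k::int. k < 0 \<and> q = of_int k \<longrightarrow>
       q_eulerian n q \<in> RZ {1..} \<and>
       exact_pow_dvd 1 (nat (max (int n + k) 0)) (q_eulerian n q)) \<and>
    (n \<ge> 1 \<longrightarrow> q_eulerian n (-1) = - ([:-1, 1:] ^ (n - 1)))"
proof (intro conjI impI allI)
  assume "q > 0 \<and> n \<ge> 2"
  then show "q_eulerian n q \<in> RZ {..0}" "simple_zeros (q_eulerian n q)"
    using q_eulerian_RZ_less_0[of q n] by (auto intro: RZ_mono simple_zerosI)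
next
  assume q: "real n + q \<le> 0 \<and> \<not> (n = 0 \<and> q = 0)"
  show "q_eulerian (n + 1) q \<in> RZ {1..}"
  proof (cases n)
    case 0
    then show ?thesis using q by (simp add: q_eulerian_1 const_RZ)
  next
    case (Suc l)
    \<comment> \<open>Here \<open>l + q < 0\<close> holds strictly; only the final step can have
      \<open>n + q = 0\<close> and so bring in the zero 1.\<close>
    then have "q_eulerian n q \<in> RZ {1<..}"
      using q by (auto intro: q_eulerian_RZ_gt_1)
    then show ?thesis
      using euler_step_RZ_ge_1(1)[of "q_eulerian n q" n q] degree_q_eulerian[of l q] q Suc
      by (simp add: q_eulerian_Suc_step)
  qed
next
  fix k :: int
  assume k: "k < 0 \<and> q = of_int k"
  define m where "m = nat (- k)"
  have "m > 0" "q = - real m" "nat (max (int n + k) 0) = n - m"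
    using k by (auto simp: m_def)
  then show "q_eulerian n q \<in> RZ {1..}" "exact_pow_dvd 1 (nat (max (int n + k) 0)) (q_eulerian n q)"
    using q_eulerian_neg_int by auto
next
  assume "n \<ge> 1"
  then obtain l where l: "n = 1 + l" using le_Suc_ex by blast
  \<comment> \<open>For \<open>m = 1\<close> the initial cofactor is the constant -1, and
    \<open>lower_step 1\<close> fixes constants.\<close>
  have iter: "(lower_step 1 ^^ k) [:-1:] = [:-1:]" for k
    by (induction k) (simp_all add: lower_step_def)
  have "q_eulerian (1 + l) (- real 1) = [:-1, 1:] ^ l * [:-1:]"
    unfolding q_eulerian_neg by (simp only: q_eulerian_1[folded One_nat_def] of_nat_1 iter)
  then show "q_eulerian n (-1) = - ([:-1, 1:] ^ (n - 1))"
    by (simp add: l)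
qed

end
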